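(* Let $\mathcal{M}=(\mathbb{R}^2,\nabla)$, where $\nabla$ is a non-flat torsion-free connection with constant Christoffel symbols in the standard coordinates, and suppose that its Ricci tensor $\rho$ has rank $1$. \begin{enumerate} \item There exists a $1$-form $\omega$ so that $\nabla^k\rho=(k+1)!\,\omega^k\otimes\rho$ for any $k$. \item $\rho$ is recurrent. \item $\operatorname{Ker}\{\rho\}$ is a parallel distribution. \item For $X\in T_PM$ with $\rho(X,X)\ne0$, the quantities $\alpha_X(\mathcal{M}):=\nabla\rho(X,X;X)^2\cdot\rho(X,X)^{-3}$ and $\epsilon_X(\mathcal{M}):=\operatorname{Sign}\{\rho(X,X)\}=\pm1$ are independent of the choice of $X$, and determine invariants $\alpha(\mathcal{M})$ and $\epsilon(\mathcal{M})$. \end{enumerate}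
   Context: $R(\xi_1,\xi_2)=\nabla_{\xi_1}\nabla_{\xi_2}-\nabla_{\xi_2}\nabla_{\xi_1}-\nabla_{[\xi_1,\xi_2]}$ and $\rho(\xi_1,\xi_2)=\operatorname{Tr}\{\xi_3\mapsto R(\xi_3,\xi_1)\xi_2\}$ (symmetric here). $\omega^k$ denotes the $k$-fold tensor power $\omega\otimes\cdots\otimes\omega$. A tensor $T$ is recurrent if $\nabla T=\eta\otimes T$ for some $1$-form $\eta$. $\operatorname{Ker}\{\rho\}=\{Y:\rho(Y,\cdot)=0\}$. *)

theory Defs
  imports "HOL-Analysis.Analysis"
begin

text \<open>Intended for open \<open>U\<close>: iterated directional derivatives exist and are continuous, so
  \<open>Ck_on n\<close> is the usual class of \<open>n\<close> times continuously differentiable maps.\<close>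

primrec Ck_on :: "nat \<Rightarrow> ('a::euclidean_space) set \<Rightarrow> ('a \<Rightarrow> 'b::euclidean_space) \<Rightarrow> bool" where
  "Ck_on 0 U f \<longleftrightarrow> continuous_on U f"
| "Ck_on (Suc n) U f \<longleftrightarrow>
     f differentiable_on U \<and> (\<forall>v. Ck_on n U (\<lambda>x. frechet_derivative f (at x) v))"

definition smooth_on :: "('a::euclidean_space) set \<Rightarrow> ('a \<Rightarrow> 'b::euclidean_space) \<Rightarrow> bool" where
  "smooth_on U f \<longleftrightarrow> (\<forall>n. Ck_on n U f)"

text \<open>Every tangent space of the plane is identified with \<open>real^2\<close>. A field defined only on an
  open set is a total function whose values elsewhere are irrelevant.\<close>

type_synonym vfield = "real^2 \<Rightarrow> real^2"

text \<open>Constant Christoffel symbols: \<open>C i j k\<close> is the coefficient of \<open>\<partial>\<^sub>k\<close> in the covariant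
  derivative of \<open>\<partial>\<^sub>j\<close> in the direction \<open>\<partial>\<^sub>i\<close>.\<close>

type_synonym christoffel = "2 \<Rightarrow> 2 \<Rightarrow> 2 \<Rightarrow> real"

definition nabla :: "christoffel \<Rightarrow> vfield \<Rightarrow> vfield \<Rightarrow> vfield" where
  "nabla C X Y p = frechet_derivative Y (at p) (X p)
     + (\<chi> k. \<Sum>i\<in>UNIV. \<Sum>j\<in>UNIV. C i j k * X p $ i * Y p $ j)"

definition lie_bracket :: "vfield \<Rightarrow> vfield \<Rightarrow> vfield" where
  "lie_bracket X Y p = frechet_derivative Y (at p) (X p) - frechet_derivative X (at p) (Y p)"

definition torsion_free :: "christoffel \<Rightarrow> bool" where
  "torsion_free C \<longleftrightarrow> (\<forall>X Y p. smooth_on UNIV X \<longrightarrow> smooth_on UNIV Y \<longrightarrow>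
     nabla C X Y p - nabla C Y X p = lie_bracket X Y p)"

definition curvature :: "christoffel \<Rightarrow> vfield \<Rightarrow> vfield \<Rightarrow> vfield \<Rightarrow> vfield" where
  "curvature C X Y Z p = nabla C X (nabla C Y Z) p - nabla C Y (nabla C X Z) p
     - nabla C (lie_bracket X Y) Z p"

definition flat :: "christoffel \<Rightarrow> bool" where
  "flat C \<longleftrightarrow> (\<forall>X Y Z p. smooth_on UNIV X \<longrightarrow> smooth_on UNIV Y \<longrightarrow> smooth_on UNIV Z \<longrightarrow>
     curvature C X Y Z p = 0)"

text \<open>Tangent vectors are extended to constant fields; as the curvature is a tensor, the choice
  of extension does not matter.\<close>

definition ricci :: "christoffel \<Rightarrow> real^2 \<Rightarrow> real^2 \<Rightarrow> real^2 \<Rightarrow> real" where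
  "ricci C p v w = trace (matrix (\<lambda>u. curvature C (\<lambda>_. u) (\<lambda>_. v) (\<lambda>_. w) p))"

definition ricci_rank :: "christoffel \<Rightarrow> real^2 \<Rightarrow> nat" where
  "ricci_rank C p = rank ((\<chi> i j. ricci C p (axis i 1) (axis j 1)) :: real^2^2)"

text \<open>A covariant tensor field of degree \<open>r\<close>, evaluated at a point and on a list of \<open>r\<close> tangent
  vectors; values on lists of other lengths are irrelevant.\<close>

type_synonym tensor = "real^2 \<Rightarrow> (real^2) list \<Rightarrow> real"

definition ricci_tensor :: "christoffel \<Rightarrow> tensor" where
  "ricci_tensor C p vs = ricci C p (vs ! 0) (vs ! 1)"

text \<open>The covariant derivative \<open>Z(T(Y\<^sub>1,\<dots>,Y\<^sub>r)) - \<Sum>\<^sub>i T(Y\<^sub>1,\<dots>,\<nabla>\<^sub>Z Y\<^sub>i,\<dots>,Y\<^sub>r)\<close>, computed with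
  constant extensions of the arguments. The new differentiation slot is the first one, which is
  the order in \<open>\<nabla>T = \<eta> \<otimes> T\<close>.\<close>

definition cov_deriv :: "christoffel \<Rightarrow> tensor \<Rightarrow> tensor" where
  "cov_deriv C T p zvs = (let z = hd zvs; vs = tl zvs in
     frechet_derivative (\<lambda>q. T q vs) (at p) z
       - (\<Sum>i<length vs. T p (vs[i := nabla C (\<lambda>_. z) (\<lambda>_. vs ! i) p])))"

type_synonym form1 = "real^2 \<Rightarrow> real^2 \<Rightarrow> real"

definition one_form :: "form1 \<Rightarrow> bool" where
  "one_form w \<longleftrightarrow> (\<forall>p. linear (w p)) \<and> (\<forall>v. smooth_on UNIV (\<lambda>p. w p v))"

definition form_power :: "form1 \<Rightarrow> nat \<Rightarrow> tensor" where
  "form_power w k p vs = (\<Prod>i<k. w p (vs ! i))"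

text \<open>The first factor has degree \<open>k\<close>.\<close>

definition tensor_prod :: "nat \<Rightarrow> tensor \<Rightarrow> tensor \<Rightarrow> tensor" where
  "tensor_prod k S T p vs = S p (take k vs) * T p (drop k vs)"

text \<open>Here \<open>T\<close> has degree \<open>r\<close>; the first power of a 1-form is the 1-form itself as a tensor.\<close>

definition recurrent :: "christoffel \<Rightarrow> nat \<Rightarrow> tensor \<Rightarrow> bool" where
  "recurrent C r T \<longleftrightarrow> (\<exists>h. one_form h \<and>
     (\<forall>p vs. length vs = r + 1 \<longrightarrow> cov_deriv C T p vs = tensor_prod 1 (form_power h 1) T p vs))"

definition ricci_kernel :: "christoffel \<Rightarrow> real^2 \<Rightarrow> (real^2) set" where
  "ricci_kernel C p = {v. \<forall>w. ricci C p v w = 0}"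

text \<open>A smooth distribution of constant rank: given constant dimension, local smooth sections
  through each vector provide local smooth frames.\<close>

definition distribution :: "(real^2 \<Rightarrow> (real^2) set) \<Rightarrow> bool" where
  "distribution D \<longleftrightarrow> (\<exists>r. \<forall>p. subspace (D p) \<and> dim (D p) = r) \<and>
     (\<forall>p. \<forall>v\<in>D p. \<exists>U Y. open U \<and> p \<in> U \<and> smooth_on U Y \<and> Y p = v \<and> (\<forall>q\<in>U. Y q \<in> D q))"

definition parallel_distribution :: "christoffel \<Rightarrow> (real^2 \<Rightarrow> (real^2) set) \<Rightarrow> bool" where
  "parallel_distribution C D \<longleftrightarrow> distribution D \<and>
     (\<forall>U X Y. open U \<longrightarrow> smooth_on U X \<longrightarrow> smooth_on U Y \<longrightarrow> (\<forall>q\<in>U. Y q \<in> D q) \<longrightarrow>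
        (\<forall>q\<in>U. nabla C X Y q \<in> D q))"

definition alpha_at :: "christoffel \<Rightarrow> real^2 \<Rightarrow> real^2 \<Rightarrow> real" where
  "alpha_at C p x = (cov_deriv C (ricci_tensor C) p [x, x, x])\<^sup>2 / (ricci C p x x) ^ 3"

definition epsilon_at :: "christoffel \<Rightarrow> real^2 \<Rightarrow> real^2 \<Rightarrow> real" where
  "epsilon_at C p x = sgn (ricci C p x x)"

definition alpha_inv :: "christoffel \<Rightarrow> real" where
  "alpha_inv C = (THE a. \<forall>p x. ricci C p x x \<noteq> 0 \<longrightarrow> alpha_at C p x = a)"

definition epsilon_inv :: "christoffel \<Rightarrow> real" where
  "epsilon_inv C = (THE e. \<forall>p x. ricci C p x x \<noteq> 0 \<longrightarrow> epsilon_at C p x = e)"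

text \<open>In \<open>push_forward f g\<close>, the map \<open>g\<close> is the inverse of the diffeomorphism \<open>f\<close>.\<close>

definition push_forward :: "(real^2 \<Rightarrow> real^2) \<Rightarrow> (real^2 \<Rightarrow> real^2) \<Rightarrow> vfield \<Rightarrow> vfield" where
  "push_forward f g X q = frechet_derivative f (at (g q)) (X (g q))"

text \<open>Existence of an affine diffeomorphism between nonempty open subsets of the two planes. Any
  globally defined affine diffeomorphism is the case where both subsets are the whole plane.\<close>

definition locally_affine_equivalent :: "christoffel \<Rightarrow> christoffel \<Rightarrow> bool" where
  "locally_affine_equivalent C C' \<longleftrightarrow> (\<exists>U V f g.
     open U \<and> open V \<and> U \<noteq> {} \<and> homeomorphism U V f g \<and> smooth_on U f \<and> smooth_on V g \<and>
     (\<forall>X Y. smooth_on U X \<longrightarrow> smooth_on U Y \<longrightarrow>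
        (\<forall>q\<in>V. nabla C' (push_forward f g X) (push_forward f g Y) q
                 = push_forward f g (nabla C X Y) q)))"

end

theory Submission
  imports Defs
begin

text \<open>A connection with constant symmetric symbols is a commutative product \<open>u * v\<close> on the plane, and its
  Ricci form is the constant symmetric form \<open>\<rho>(v,w) = tr (u \<mapsto> u * (v * w) - v * (u * w))\<close>. When \<open>\<rho>\<close> has
  rank one, its kernel is an ideal of this product, so that the product descends to the quotient line,
  which says \<open>\<rho>(z * v, w) = -\<omega>(z) \<rho>(v,w)\<close> for a linear form \<open>\<omega>\<close> that vanishes on the kernel. Then
  \<open>\<nabla>\<rho> = 2 \<omega> \<otimes> \<rho>\<close> and \<open>\<nabla>\<omega> = \<omega> \<otimes> \<omega>\<close>, and everything pointwise follows. An affine diffeomorphism intertwines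
  the curvatures, hence the forms \<open>\<rho>\<close> and \<open>\<nabla>\<rho>\<close>, from which the invariants are computed.\<close>

section \<open>Smooth maps and symmetry of mixed second derivatives\<close>

lemma Ck_on_const: "Ck_on n U (\<lambda>_. c)"
  by (induction n arbitrary: c) simp_all

lemma smooth_on_const: "smooth_on U (\<lambda>_. c)"
  by (simp add: smooth_on_def Ck_on_const)

lemma smooth_on_has_derivative:
  assumes "smooth_on U f" "open U" "q \<in> U"
  shows "(f has_derivative frechet_derivative f (at q)) (at q)"
    and "((\<lambda>x. frechet_derivative f (at x) v) has_derivative
           frechet_derivative (\<lambda>x. frechet_derivative f (at x) v) (at q)) (at q)"
proof -
  have "Ck_on (Suc (Suc 0)) U f"
    using assms(1) unfolding smooth_on_def by blast
  then have "f differentiable_on U" "(\<lambda>x. frechet_derivative f (at x) v) differentiable_on U"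
    by auto
  then have "f differentiable at q" "(\<lambda>x. frechet_derivative f (at x) v) differentiable at q"
    using assms(2,3) by (auto simp: differentiable_on_eq_differentiable_at)
  then show "(f has_derivative frechet_derivative f (at q)) (at q)"
    "((\<lambda>x. frechet_derivative f (at x) v) has_derivative
           frechet_derivative (\<lambda>x. frechet_derivative f (at x) v) (at q)) (at q)"
    by (simp_all add: frechet_derivative_works)
qed

text \<open>The mean value theorem is applied twice: along \<open>u\<close> to a difference in
  direction \<open>v\<close>, then along \<open>v\<close> to the derivative in direction
  \<open>u\<close>.\<close>

lemma second_difference_mvt:
  fixes h :: "'a::real_normed_vector \<Rightarrow> real"
  assumes ball: "ball p r \<subseteq> U" and t: "0 < t" "t * (norm u + norm v) < r"
    and h: "\<And>q. q \<in> U \<Longrightarrow> (h has_derivative h' q) (at q)"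
    and h': "\<And>q. q \<in> U \<Longrightarrow> ((\<lambda>q. h' q u) has_derivative A q) (at q)"
  obtains s s' where "0 < s" "s < t" "0 < s'" "s' < t"
    "h (p + t *\<^sub>R u + t *\<^sub>R v) - h (p + t *\<^sub>R u) - h (p + t *\<^sub>R v) + h p
       = t\<^sup>2 * A (p + s *\<^sub>R u + s' *\<^sub>R v) v"
proof -
  have inU: "p + x *\<^sub>R u + y *\<^sub>R v \<in> U" if "0 \<le> x" "x \<le> t" "0 \<le> y" "y \<le> t" for x y
  proof -
    have "norm (x *\<^sub>R u + y *\<^sub>R v) \<le> x * norm u + y * norm v"
      using norm_triangle_ineq[of "x *\<^sub>R u" "y *\<^sub>R v"] that by simp
    also have "\<dots> \<le> t * norm u + t * norm v"
      using that by (intro add_mono mult_right_mono) auto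
    also have "\<dots> < r"
      using t by (simp add: algebra_simps)
    finally have "dist (p + x *\<^sub>R u + y *\<^sub>R v) p < r"
      by (simp add: dist_norm add.assoc)
    then show ?thesis
      using ball by (auto simp: dist_commute)
  qed
  have lin: "linear (h' q)" "linear (A q)" if "q \<in> U" for q
    using h[OF that] h'[OF that] has_derivative_linear by blast+
  \<comment> \<open>The second difference is \<open>\<phi> t - \<phi> 0\<close>.\<close>
  define \<phi> where "\<phi> x = h (p + x *\<^sub>R u + t *\<^sub>R v) - h (p + x *\<^sub>R u)" for x
  have d\<phi>: "(\<phi> has_real_derivative h' (p + x *\<^sub>R u + t *\<^sub>R v) u - h' (p + x *\<^sub>R u) u) (at x)"
    if "0 \<le> x" "x \<le> t" for x
  proof -
    have *: "p + x *\<^sub>R u + t *\<^sub>R v \<in> U" "p + x *\<^sub>R u \<in> U"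
      using inU[of x t] inU[of x 0] that t by auto
    have "(\<phi> has_derivative (\<lambda>d. h' (p + x *\<^sub>R u + t *\<^sub>R v) (d *\<^sub>R u) - h' (p + x *\<^sub>R u) (d *\<^sub>R u))) (at x)"
      unfolding \<phi>_def
      by (intro has_derivative_diff has_derivative_compose[where f = "\<lambda>x. p + x *\<^sub>R u + t *\<^sub>R v", OF _ h[OF *(1)]]
          has_derivative_compose[where f = "\<lambda>x. p + x *\<^sub>R u", OF _ h[OF *(2)]])
        (auto intro!: derivative_eq_intros)
    moreover have "(\<lambda>d. h' (p + x *\<^sub>R u + t *\<^sub>R v) (d *\<^sub>R u) - h' (p + x *\<^sub>R u) (d *\<^sub>R u))
        = (*) (h' (p + x *\<^sub>R u + t *\<^sub>R v) u - h' (p + x *\<^sub>R u) u)"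
      using lin(1)[OF *(1)] lin(1)[OF *(2)] by (auto simp: linear_cmul algebra_simps)
    ultimately show ?thesis
      by (simp add: has_field_derivative_def)
  qed
  obtain s where s: "0 < s" "s < t"
    "\<phi> t - \<phi> 0 = t * (h' (p + s *\<^sub>R u + t *\<^sub>R v) u - h' (p + s *\<^sub>R u) u)"
    using MVT2[OF t(1) d\<phi>] by auto
  have d\<psi>: "((\<lambda>y. h' (p + s *\<^sub>R u + y *\<^sub>R v) u) has_real_derivative A (p + s *\<^sub>R u + y *\<^sub>R v) v) (at y)"
    if "0 \<le> y" "y \<le> t" for y
  proof -
    have *: "p + s *\<^sub>R u + y *\<^sub>R v \<in> U"
      using inU[of s y] that s by auto
    have "((\<lambda>y. h' (p + s *\<^sub>R u + y *\<^sub>R v) u) has_derivative (\<lambda>d. A (p + s *\<^sub>R u + y *\<^sub>R v) (d *\<^sub>R v))) (at y)"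
      by (rule has_derivative_compose[where f = "\<lambda>y. p + s *\<^sub>R u + y *\<^sub>R v", OF _ h'[OF *]]) (auto intro!: derivative_eq_intros)
    moreover have "(\<lambda>d. A (p + s *\<^sub>R u + y *\<^sub>R v) (d *\<^sub>R v)) = (*) (A (p + s *\<^sub>R u + y *\<^sub>R v) v)"
      using lin(2)[OF *] by (auto simp: linear_cmul)
    ultimately show ?thesis
      by (simp add: has_field_derivative_def)
  qed
  obtain s' where s': "0 < s'" "s' < t"
    "h' (p + s *\<^sub>R u + t *\<^sub>R v) u - h' (p + s *\<^sub>R u + 0 *\<^sub>R v) u = (t - 0) * A (p + s *\<^sub>R u + s' *\<^sub>R v) v"
    using MVT2[OF t(1) d\<psi>] by blast
  show ?thesis
  proof (rule that[OF s(1,2) s'(1,2)])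
    show "h (p + t *\<^sub>R u + t *\<^sub>R v) - h (p + t *\<^sub>R u) - h (p + t *\<^sub>R v) + h p
       = t\<^sup>2 * A (p + s *\<^sub>R u + s' *\<^sub>R v) v"
      using s(3) s'(3) by (simp add: \<phi>_def power2_eq_square)
  qed
qed

text \<open>The second difference does not change when \<open>u\<close> and \<open>v\<close> are
  exchanged. Divided by the square of \<open>t\<close>, it is a value of either mixed derivative
  near \<open>p\<close>, so continuity forces the two to agree at \<open>p\<close>.\<close>

lemma second_derivative_symmetric:
  fixes h :: "'a::real_normed_vector \<Rightarrow> real"
  assumes U: "open U" "p \<in> U"
    and h: "\<And>q. q \<in> U \<Longrightarrow> (h has_derivative h' q) (at q)"
    and A: "\<And>q. q \<in> U \<Longrightarrow> ((\<lambda>q. h' q u) has_derivative A q) (at q)"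
    and B: "\<And>q. q \<in> U \<Longrightarrow> ((\<lambda>q. h' q v) has_derivative B q) (at q)"
    and contA: "continuous_on U (\<lambda>q. A q v)" and contB: "continuous_on U (\<lambda>q. B q u)"
  shows "A p v = B p u"
proof (rule ccontr)
  assume "A p v \<noteq> B p u"
  define e where "e = dist (A p v) (B p u) / 2"
  have e: "e > 0"
    using \<open>A p v \<noteq> B p u\<close> by (simp add: e_def)
  have "\<forall>\<^sub>F q in nhds p. q \<in> U \<and> dist (A q v) (A p v) < e \<and> dist (B q u) (B p u) < e"
  proof (intro eventually_conj)
    have "isCont (\<lambda>q. A q v) p" "isCont (\<lambda>q. B q u) p"
      using contA contB U continuous_on_eq_continuous_at by blast+
    then have "filterlim (\<lambda>q. A q v) (nhds (A p v)) (nhds p)" "filterlim (\<lambda>q. B q u) (nhds (B p u)) (nhds p)"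
      using tendsto_at_iff_tendsto_nhds[of "\<lambda>q. A q v" p] tendsto_at_iff_tendsto_nhds[of "\<lambda>q. B q u" p]
      by (simp_all add: isCont_def)
    then show "\<forall>\<^sub>F q in nhds p. dist (A q v) (A p v) < e" "\<forall>\<^sub>F q in nhds p. dist (B q u) (B p u) < e"
      using e tendstoD by blast+
    show "\<forall>\<^sub>F q in nhds p. q \<in> U"
      using U eventually_nhds by blast
  qed
  then obtain r where r: "r > 0" "\<And>q. dist q p < r \<Longrightarrow> q \<in> U \<and> dist (A q v) (A p v) < e \<and> dist (B q u) (B p u) < e"
    unfolding eventually_nhds_metric by blast
  then have ball: "ball p r \<subseteq> U"
    by (auto simp: dist_commute)
  \<comment> \<open>The parallelogram with sides \<open>t\<close> times \<open>u\<close> and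
    \<open>v\<close> then stays in the ball; the added 1 keeps the denominator positive when both
    vectors vanish.\<close>
  define t where "t = r / (2 * (norm u + norm v + 1))"
  have pos: "norm u + norm v + 1 > 0"
    by (meson add_nonneg_pos add_nonneg_nonneg norm_ge_zero zero_less_one)
  have t: "t > 0"
    using r pos by (simp add: t_def)
  have "t * (norm u + norm v + 1) = r / 2"
    using pos by (simp add: t_def field_simps)
  then have tr: "t * (norm u + norm v) < r" "t * (norm v + norm u) < r"
    using r t by (auto simp: algebra_simps)
  have near: "dist (p + x *\<^sub>R u + y *\<^sub>R v) p < r" if "0 < x" "x < t" "0 < y" "y < t" for x y
  proof -
    have "norm (x *\<^sub>R u + y *\<^sub>R v) \<le> x * norm u + y * norm v"
      using norm_triangle_ineq[of "x *\<^sub>R u" "y *\<^sub>R v"] that by simp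
    also have "\<dots> \<le> t * norm u + t * norm v"
      using that by (intro add_mono mult_right_mono) auto
    also have "\<dots> < r"
      using tr by (simp add: algebra_simps)
    finally show ?thesis
      by (simp add: dist_norm add.assoc)
  qed
  obtain s s' where s: "0 < s" "s < t" "0 < s'" "s' < t"
    "h (p + t *\<^sub>R u + t *\<^sub>R v) - h (p + t *\<^sub>R u) - h (p + t *\<^sub>R v) + h p
       = t\<^sup>2 * A (p + s *\<^sub>R u + s' *\<^sub>R v) v"
    using second_difference_mvt[OF ball t tr(1) h A] by metis
  obtain w w' where w: "0 < w" "w < t" "0 < w'" "w' < t"
    "h (p + t *\<^sub>R v + t *\<^sub>R u) - h (p + t *\<^sub>R v) - h (p + t *\<^sub>R u) + h p
       = t\<^sup>2 * B (p + w *\<^sub>R v + w' *\<^sub>R u) u"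
    using second_difference_mvt[OF ball t tr(2) h B] by metis
  have "t\<^sup>2 * A (p + s *\<^sub>R u + s' *\<^sub>R v) v = t\<^sup>2 * B (p + w' *\<^sub>R u + w *\<^sub>R v) u"
    using s(5) w(5) by (simp add: algebra_simps)
  then have "A (p + s *\<^sub>R u + s' *\<^sub>R v) v = B (p + w' *\<^sub>R u + w *\<^sub>R v) u"
    using t by simp
  moreover have "dist (A (p + s *\<^sub>R u + s' *\<^sub>R v) v) (A p v) < e"
    using r(2) near s by blast
  moreover have "dist (B (p + w' *\<^sub>R u + w *\<^sub>R v) u) (B p u) < e"
    using r(2) near w by blast
  \<comment> \<open>One common value would lie within \<open>e\<close>, half of their distance, of
    both derivatives at \<open>p\<close>.\<close>
  ultimately show False
    unfolding e_def by (metis dist_triangle_half_r less_irrefl)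
qed

section \<open>The product of the connection and its Ricci form\<close>

definition cmult :: "christoffel \<Rightarrow> real^2 \<Rightarrow> real^2 \<Rightarrow> real^2" where
  "cmult C u v = (\<chi> k. \<Sum>i\<in>UNIV. \<Sum>j\<in>UNIV. C i j k * u $ i * v $ j)"

lemma bounded_bilinear_cmult: "bounded_bilinear (cmult C)"
  unfolding bilinear_conv_bounded_bilinear[symmetric] bilinear_def cmult_def
  by (auto intro!: linearI simp: vec_eq_iff sum_2 algebra_simps)

interpretation cmult: bounded_bilinear "cmult C" for C
  by (rule bounded_bilinear_cmult)

lemma nabla_eq: "nabla C X Y p = frechet_derivative Y (at p) (X p) + cmult C (X p) (Y p)"
  by (simp add: nabla_def cmult_def)

lemma nabla_const: "nabla C X (\<lambda>_. v) = (\<lambda>p. cmult C (X p) v)"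
  by (rule ext) (simp add: nabla_eq)

lemma torsion_free_cmult_commute:
  assumes "torsion_free C"
  shows "cmult C u v = cmult C v u"
proof -
  have "nabla C (\<lambda>_. u) (\<lambda>_. v) 0 - nabla C (\<lambda>_. v) (\<lambda>_. u) 0 = lie_bracket (\<lambda>_. u) (\<lambda>_. v) 0"
    using assms smooth_on_const unfolding torsion_free_def by blast
  then show ?thesis
    by (simp add: nabla_const lie_bracket_def)
qed

lemma curvature_const:
  "curvature C (\<lambda>_. u) (\<lambda>_. v) (\<lambda>_. w) p = cmult C u (cmult C v w) - cmult C v (cmult C u w)"
  by (simp add: curvature_def nabla_const lie_bracket_def cmult.zero_left)

text \<open>There is no base point because constant symbols make the curvature of constant fields
  constant.\<close>

definition ric :: "christoffel \<Rightarrow> real^2 \<Rightarrow> real^2 \<Rightarrow> real" where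
  "ric C v w = trace (matrix (\<lambda>u. cmult C u (cmult C v w) - cmult C v (cmult C u w)))"

lemma ricci_eq_ric: "ricci C p = ric C"
  by (intro ext) (simp add: ricci_def ric_def curvature_const)

lemma ric_eq_sum:
  "ric C v w = (\<Sum>i\<in>UNIV. cmult C (axis i 1) (cmult C v w) $ i - cmult C v (cmult C (axis i 1) w) $ i)"
  by (simp add: ric_def trace_def matrix_def)

lemma bounded_bilinear_ric: "bounded_bilinear (ric C)"
  unfolding bilinear_conv_bounded_bilinear[symmetric] bilinear_def
  by (auto intro!: linearI simp: ric_eq_sum sum_2 cmult.add_left cmult.add_right
        cmult.scaleR_left cmult.scaleR_right algebra_simps)

interpretation ric: bounded_bilinear "ric C" for C
  by (rule bounded_bilinear_ric)


lemma torsion_free_christoffel_commute: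
  assumes "torsion_free C"
  shows "C i j k = C j i k"
proof -
  have "cmult C (axis i 1) (axis j 1) $ k = C i j k" for i j
    using exhaust_2[of i] exhaust_2[of j] by (auto simp: cmult_def sum_2 axis_def)
  then show ?thesis
    using torsion_free_cmult_commute[OF assms] by metis
qed

text \<open>With L_v the multiplication by \<open>v\<close>, commutativity turns the form into tr
  L_(v * w) - tr (L_v L_w), and both traces are symmetric. The check is done in coordinates.\<close>

lemma ric_commute:
  assumes "torsion_free C"
  shows "ric C v w = ric C w v"
  using torsion_free_christoffel_commute[OF assms, of 2 1]
  by (simp add: ric_eq_sum sum_2 cmult_def axis_def algebra_simps)

lemma ric_axis:
  "ric C v w = ric C (axis 1 1) (axis 1 1) * v$1 * w$1 + ric C (axis 1 1) (axis 2 1) * v$1 * w$2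
     + ric C (axis 2 1) (axis 1 1) * v$2 * w$1 + ric C (axis 2 1) (axis 2 1) * v$2 * w$2"
proof -
  have *: "x = x$1 *\<^sub>R axis 1 1 + x$2 *\<^sub>R axis 2 1" for x :: "real^2"
    by (simp add: vec_eq_iff forall_2 axis_def)
  show ?thesis
    by (subst *[of v], subst *[of w])
      (simp add: ric.add_left ric.add_right ric.scaleR_left ric.scaleR_right algebra_simps)
qed

text \<open>With \<open>k = \<rho>(x,x) z - \<rho>(z,x) x\<close>, the left-hand side is \<open>\<rho>(k * v, w)\<close>. When the determinant of
  \<open>\<rho>\<close> vanishes, \<open>k\<close> lies in its kernel, and the identity says that multiplication by \<open>k\<close>
  takes values in the kernel.\<close>

lemma ric_cmult_identity:
  assumes "torsion_free C"
  shows "ric C x x * ric C (cmult C z v) w - ric C z x * ric C (cmult C x v) w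
    = (ric C (axis 1 1) (axis 1 1) * ric C (axis 2 1) (axis 2 1) - (ric C (axis 1 1) (axis 2 1))\<^sup>2)
      * (x$1 * z$2 - x$2 * z$1) * (x$1 * cmult C v w $ 2 - x$2 * cmult C v w $ 1)"
proof -
  define a b c d e f where "a = C 1 1 1" "b = C 1 1 2" "c = C 1 2 1" "d = C 1 2 2" "e = C 2 2 1" "f = C 2 2 2"
  note abc = this
  define p q r where "p = ric C (axis 1 1) (axis 1 1)" "q = ric C (axis 1 1) (axis 2 1)" "r = ric C (axis 2 1) (axis 2 1)"
  note pqr = this
  have sym: "C 2 1 1 = c" "C 2 1 2 = d"
    using torsion_free_christoffel_commute[OF assms, of 2 1] by (simp_all add: abc)
  have m: "cmult C u v $ 1 = a * u$1 * v$1 + c * (u$1 * v$2 + u$2 * v$1) + e * u$2 * v$2"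
     "cmult C u v $ 2 = b * u$1 * v$1 + d * (u$1 * v$2 + u$2 * v$1) + f * u$2 * v$2" for u v
    by (simp_all add: cmult_def sum_2 sym abc[symmetric] algebra_simps)
  have "p = d * (a - d) + b * (f - c)" "q = c * d - b * e" "r = e * (a - d) + c * (f - c)"
    unfolding pqr ric_eq_sum sum_2 m by (simp_all add: axis_def algebra_simps)
  \<comment> \<open>These two relations between symbols and Ricci entries carry the content: the
    eight coefficient identities below reduce to them.\<close>
  then have rel: "d * r - e * p = (f - c) * q" "b * r - c * p = - (a - d) * q"
    by algebra+
  have R: "ric C v w = p * v$1 * w$1 + q * (v$1 * w$2 + v$2 * w$1) + r * v$2 * w$2" for v w
    using ric_axis[of C v w] ric_commute[OF assms, of "axis 2 1" "axis 1 1"] unfolding pqr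
    by (simp add: algebra_simps)
  show ?thesis
  proof -
    \<comment> \<open>By linearity in the first factor of the product, the cases of the two basis
      vectors suffice; \<open>D\<close> is the determinant of the form.\<close>
    define D \<alpha> \<beta> where "D = p * r - q\<^sup>2"
      and "\<alpha> = ric C (cmult C (axis 1 1) v) w" and "\<beta> = ric C (cmult C (axis 2 1) v) w"
    note D = D_def
    have \<alpha>: "\<alpha> = v$1 * w$1 * (p * a + q * b) + v$1 * w$2 * (q * a + r * b)
        + v$2 * w$1 * (p * c + q * d) + v$2 * w$2 * (q * c + r * d)"
      by (simp add: \<alpha>_def R m) (simp add: axis_def algebra_simps)
    have \<beta>: "\<beta> = v$1 * w$1 * (p * c + q * d) + v$1 * w$2 * (q * c + r * d)
        + v$2 * w$1 * (p * e + q * f) + v$2 * w$2 * (q * e + r * f)"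
      by (simp add: \<beta>_def R m) (simp add: axis_def algebra_simps)
    have 1: "p * (p * c + q * d) - q * (p * a + q * b) = D * b"
      "p * (q * c + r * d) - q * (q * a + r * b) = D * d"
      "p * (p * e + q * f) - q * (p * c + q * d) = D * d"
      "p * (q * e + r * f) - q * (q * c + r * d) = D * f"
      using rel unfolding D by algebra+
    have 2: "q * (p * c + q * d) - r * (p * a + q * b) = - D * a"
      "q * (q * c + r * d) - r * (q * a + r * b) = - D * c"
      "q * (p * e + q * f) - r * (p * c + q * d) = - D * c"
      "q * (q * e + r * f) - r * (q * c + r * d) = - D * e"
      using rel unfolding D by algebra+
    have "p * \<beta> - q * \<alpha> = v$1 * w$1 * (p * (p * c + q * d) - q * (p * a + q * b))
        + v$1 * w$2 * (p * (q * c + r * d) - q * (q * a + r * b))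
        + v$2 * w$1 * (p * (p * e + q * f) - q * (p * c + q * d))
        + v$2 * w$2 * (p * (q * e + r * f) - q * (q * c + r * d))"
      unfolding \<alpha> \<beta> by (simp add: algebra_simps)
    then have 3: "p * \<beta> - q * \<alpha> = D * cmult C v w $ 2"
      unfolding 1 m by (simp add: algebra_simps)
    have "q * \<beta> - r * \<alpha> = v$1 * w$1 * (q * (p * c + q * d) - r * (p * a + q * b))
        + v$1 * w$2 * (q * (q * c + r * d) - r * (q * a + r * b))
        + v$2 * w$1 * (q * (p * e + q * f) - r * (p * c + q * d))
        + v$2 * w$2 * (q * (q * e + r * f) - r * (q * c + r * d))"
      unfolding \<alpha> \<beta> by (simp add: algebra_simps)
    then have 4: "q * \<beta> - r * \<alpha> = - D * cmult C v w $ 1"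
      unfolding 2 m by (simp add: algebra_simps)
    have T: "ric C (cmult C u v) w = u$1 * \<alpha> + u$2 * \<beta>" for u
      unfolding \<alpha> \<beta> by (simp add: R m algebra_simps)
    \<comment> \<open>The left-hand side is linear in \<open>z\<close> and vanishes at
      \<open>z = x\<close>, hence the determinant of \<open>x\<close> and \<open>z\<close> as a
      factor.\<close>
    have "ric C x x * ric C (cmult C z v) w - ric C z x * ric C (cmult C x v) w
        = (x$1 * z$2 - x$2 * z$1) * (x$1 * (p * \<beta> - q * \<alpha>) + x$2 * (q * \<beta> - r * \<alpha>))"
      unfolding T R[of x x] R[of z x] by (simp add: algebra_simps)
    then show ?thesis
      unfolding 3 4 D_def[symmetric] pqr[symmetric] by (simp add: algebra_simps)
  qed
qed

section \<open>Ricci forms of rank one\<close>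

text \<open>For the second claim: if the diagonal vanished, the zero determinant would kill the
  off-diagonal entry too, leaving rank 0.\<close>

lemma ric_det:
  assumes "ricci_rank C 0 = 1" "torsion_free C"
  shows "ric C (axis 1 1) (axis 1 1) * ric C (axis 2 1) (axis 2 1) = (ric C (axis 1 1) (axis 2 1))\<^sup>2"
    and "\<exists>x. ric C x x \<noteq> 0"
proof -
  define M where "M = ((\<chi> i j. ric C (axis i 1) (axis j 1)) :: real^2^2)"
  have rank: "rank M = 1"
    using assms by (simp add: M_def ricci_rank_def ricci_eq_ric)
  then have "det M = 0"
    by (simp add: det_eq_0_rank)
  then show det: "ric C (axis 1 1) (axis 1 1) * ric C (axis 2 1) (axis 2 1) = (ric C (axis 1 1) (axis 2 1))\<^sup>2"
    using ric_commute[OF assms(2), of "axis 2 1" "axis 1 1"]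
    by (simp add: det_2 M_def power2_eq_square)
  show "\<exists>x. ric C x x \<noteq> 0"
  proof (rule ccontr)
    assume "\<not> ?thesis"
    then have "ric C x x = 0" for x
      by blast
    then have "M = 0"
      using det ric_commute[OF assms(2), of "axis 2 1" "axis 1 1"]
      by (simp add: M_def vec_eq_iff forall_2)
    then show False
      using rank by simp
  qed
qed

text \<open>A symmetric form of rank one is a multiple of the square of a linear form; in
  coordinates the identity follows from the vanishing determinant.\<close>

lemma ric_rank_one:
  assumes "ricci_rank C 0 = 1" "torsion_free C"
  shows "ric C x x * ric C v w = ric C v x * ric C w x"
proof -
  let ?p = "ric C (axis 1 1) (axis 1 1)" and ?q = "ric C (axis 1 1) (axis 2 1)" and ?r = "ric C (axis 2 1) (axis 2 1)"
  have R: "ric C v w = ?p * v$1 * w$1 + ?q * (v$1 * w$2 + v$2 * w$1) + ?r * v$2 * w$2" for v w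
    using ric_axis[of C v w] ric_commute[OF assms(2), of "axis 2 1" "axis 1 1"]
    by (simp add: algebra_simps)
  show ?thesis
    unfolding R[of x x] R[of v w] R[of v x] R[of w x] using ric_det(1)[OF assms] by algebra
qed

text \<open>This is \<omega>. Vanishing on the kernel makes it a multiple of \<rho>(z,x), and the
  factor is fixed by \<rho>(x * x,x) = -\<omega>(x) \<rho>(x,x). The vector \<open>x\<close> is
  auxiliary: \<open>ric_cmult\<close> shows that every \<open>x\<close> with \<rho>(x,x) nonzero
  gives the same form.\<close>

definition ric_form :: "christoffel \<Rightarrow> real^2 \<Rightarrow> real^2 \<Rightarrow> real" where
  "ric_form C x z = - ric C (cmult C x x) x / (ric C x x)\<^sup>2 * ric C z x"

lemma linear_ric_form: "linear (ric_form C x)"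
  unfolding ric_form_def by (intro linearI) (simp_all add: ric.add_left ric.scaleR_left algebra_simps add_divide_distrib)

text \<open>The determinant being zero, a factor \<open>z\<close> of the product may be traded for
  \<open>x\<close> at the cost of \<rho>(z,x) / \<rho>(x,x). Doing this to both factors leaves
  \<rho>(x * x,w), and rank one reduces \<open>w\<close> to \<open>x\<close>.\<close>

lemma ric_cmult:
  assumes C: "ricci_rank C 0 = 1" "torsion_free C" and x: "ric C x x \<noteq> 0"
  shows "ric C (cmult C z v) w = - ric_form C x z * ric C v w"
proof -
  have shift: "ric C x x * ric C (cmult C z v) w = ric C z x * ric C (cmult C x v) w" for z v w
    using ric_cmult_identity[OF C(2), of x z v w] ric_det(1)[OF C] by simp
  have "ric C x x * ric C (cmult C x v) w = ric C v x * ric C (cmult C x x) w"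
    using shift[of v x w] torsion_free_cmult_commute[OF C(2)] by metis
  then have "(ric C x x)\<^sup>2 * ric C (cmult C z v) w = ric C z x * ric C v x * ric C (cmult C x x) w"
    using shift[of z v w] by algebra
  moreover have "ric C x x * ric C (cmult C x x) w = ric C (cmult C x x) x * ric C w x"
    "ric C x x * ric C v w = ric C v x * ric C w x"
    using ric_rank_one[OF C] by blast+
  ultimately have "(ric C x x)^3 * ric C (cmult C z v) w = ric C z x * ric C (cmult C x x) x * (ric C x x * ric C v w)"
    by algebra
  then show ?thesis
    using x by (simp add: ric_form_def field_simps power2_eq_square power3_eq_cube)
qed

lemma ric_cmult_right:
  assumes "ricci_rank C 0 = 1" "torsion_free C" "ric C x x \<noteq> 0"
  shows "ric C v (cmult C z w) = - ric_form C x z * ric C v w"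
  using ric_cmult[OF assms] ric_commute[OF assms(2)] by metis

text \<open>As \<omega> is a multiple of \<rho>(.,x), this is \<open>ric_cmult\<close> at
  \<open>w = x\<close>. It expresses \<nabla>\<omega> = \<omega> \<otimes> \<omega>.\<close>

lemma ric_form_cmult:
  assumes C: "ricci_rank C 0 = 1" "torsion_free C" and x: "ric C x x \<noteq> 0"
  shows "ric_form C x (cmult C z v) = - ric_form C x z * ric_form C x v"
  using ric_cmult[OF assms, of z v x] unfolding ric_form_def[of C x v] ric_form_def[of C x "cmult C z v"]
  by simp

section \<open>Covariant derivatives of the Ricci tensor and its kernel\<close>

lemma cov_deriv_ric:
  "cov_deriv C (ricci_tensor C) p [z, v, w] = - ric C (cmult C z v) w - ric C v (cmult C z w)"
  by (simp add: cov_deriv_def ricci_tensor_def ricci_eq_ric nabla_const lessThan_Suc)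

lemma tensor_prod_form_power_ricci_tensor:
  assumes "length vs = k + 2"
  shows "tensor_prod k (form_power w k) (ricci_tensor C) p vs
    = (\<Prod>i<k. w p (vs ! i)) * ric C (vs ! k) (vs ! Suc k)"
  using assms by (simp add: tensor_prod_def form_power_def ricci_tensor_def ricci_eq_ric)

text \<open>Each of the k + 2 slots of the k-th derivative contributes one factor \<omega>(z) to the
  next derivative, so the coefficients multiply up to 2 * 3 * ... * (k + 1).\<close>

lemma iterated_cov_deriv_ric:
  assumes C: "ricci_rank C 0 = 1" "torsion_free C" and x: "ric C x x \<noteq> 0"
    and "length vs = k + 2"
  shows "(cov_deriv C ^^ k) (ricci_tensor C) p vs
     = fact (k + 1) * tensor_prod k (form_power (\<lambda>_. ric_form C x) k) (ricci_tensor C) p vs"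
  using assms(4)
proof (induction k arbitrary: p vs)
  case 0
  then show ?case
    by (simp add: tensor_prod_def form_power_def)
next
  case (Suc k)
  let ?\<omega> = "ric_form C x"
  let ?T = "(cov_deriv C ^^ k) (ricci_tensor C)"
  have T: "?T q us = fact (k + 1) * ((\<Prod>i<k. ?\<omega> (us ! i)) * ric C (us ! k) (us ! Suc k))"
    if "length us = k + 2" for q us
    using Suc.IH[OF that, of q] that
    by (simp add: tensor_prod_form_power_ricci_tensor)
  obtain z us where vs: "vs = z # us" and us: "length us = k + 2"
    using Suc.prems by (cases vs) auto
  \<comment> \<open>By induction the tensor has constant components, so only the slot terms
    survive.\<close>
  have "(\<lambda>q. ?T q us) = (\<lambda>_. fact (k + 1) * ((\<Prod>i<k. ?\<omega> (us ! i)) * ric C (us ! k) (us ! Suc k)))"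
    using T[OF us] by blast
  then have "frechet_derivative (\<lambda>q. ?T q us) (at p) z = 0"
    by (simp only: frechet_derivative_const)
  moreover have "?T p (us[i := cmult C z (us ! i)]) = - ?\<omega> z * ?T p us" if i: "i < k + 2" for i
  proof -
    consider "i < k" | "i = k" | "i = Suc k"
      using i by linarith
    then show ?thesis
    proof cases
      case 1
      have "(\<Prod>j<k. ?\<omega> (us[i := cmult C z (us ! i)] ! j)) = (\<Prod>j<k. (if j = i then - ?\<omega> z else 1) * ?\<omega> (us ! j))"
        using us i by (intro prod.cong) (auto simp: nth_list_update ric_form_cmult[OF C x])
      also have "\<dots> = - ?\<omega> z * (\<Prod>j<k. ?\<omega> (us ! j))"
        using 1 by (simp add: prod.distrib)
      finally show ?thesis
        using 1 us by (simp add: T)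
    next
      case 2
      then show ?thesis
        using us by (simp add: T ric_cmult[OF C x])
    next
      case 3
      then show ?thesis
        using us by (simp add: T ric_cmult_right[OF C x])
    qed
  qed
  ultimately have "cov_deriv C ?T p vs = (k + 2) * ?\<omega> z * ?T p us"
    using us by (simp add: cov_deriv_def vs nabla_const) (simp add: algebra_simps)
  \<comment> \<open>The new slot comes first, so the product over the slots is split at its first
    factor.\<close>
  also have "\<dots> = fact (Suc k + 1) * tensor_prod (Suc k) (form_power (\<lambda>_. ?\<omega>) (Suc k)) (ricci_tensor C) p vs"
    using us by (simp add: T vs tensor_prod_form_power_ricci_tensor prod.lessThan_Suc_shift
        del: prod.lessThan_Suc)
  finally show ?case
    by simp
qed

lemma one_form_ric_form: "one_form (\<lambda>_. ric_form C x)"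
  by (simp add: one_form_def linear_ric_form smooth_on_const)

text \<open>The case k = 1, with the factor 2! absorbed into the 1-form.\<close>

lemma recurrent_ric:
  assumes C: "ricci_rank C 0 = 1" "torsion_free C"
  shows "recurrent C 2 (ricci_tensor C)"
proof -
  obtain x where x: "ric C x x \<noteq> 0"
    using ric_det(2)[OF C] by blast
  let ?h = "\<lambda>_::real^2. \<lambda>z. 2 * ric_form C x z"
  have "one_form ?h"
    using linear_ric_form[of C x]
    by (auto simp: one_form_def smooth_on_const intro!: linear_compose_scale_right[of "ric_form C x" 2, simplified])
  moreover have "cov_deriv C (ricci_tensor C) p vs = tensor_prod 1 (form_power ?h 1) (ricci_tensor C) p vs"
    if "length vs = 2 + 1" for p vs
    using iterated_cov_deriv_ric[OF C x, of vs 1 p] that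
    by (simp add: tensor_prod_def form_power_def)
  ultimately show ?thesis
    unfolding recurrent_def by blast
qed

text \<open>The kernel is the same subspace at every point, so constant fields are sections. For a
  section \<open>Y\<close>, differentiating \<rho>(Y,w) = 0 keeps the derivative of \<open>Y\<close>
  in the kernel, and the product term stays there because the kernel is an ideal.\<close>

lemma parallel_ricci_kernel:
  assumes C: "ricci_rank C 0 = 1" "torsion_free C"
  shows "parallel_distribution C (ricci_kernel C)"
  unfolding parallel_distribution_def
proof (intro conjI allI impI ballI)
  define N where "N = {v. \<forall>w. ric C v w = 0}"
  have K: "ricci_kernel C p = N" for p
    by (simp add: N_def ricci_kernel_def ricci_eq_ric)
  have "subspace N"
    by (auto simp: subspace_def N_def ric.zero_left ric.add_left ric.scaleR_left)
  then show "distribution (ricci_kernel C)"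
    unfolding distribution_def K using smooth_on_const by (metis open_UNIV UNIV_I)
  fix U X Y q
  assume U: "open U" "q \<in> U" and Y: "smooth_on U Y" "\<forall>q\<in>U. Y q \<in> ricci_kernel C q"
  obtain x where x: "ric C x x \<noteq> 0"
    using ric_det(2)[OF C] by blast
  have 0: "ric C (Y q') w = 0" if "q' \<in> U" for q' w
    using Y(2) that by (auto simp: ricci_kernel_def ricci_eq_ric)
  have "ric C (frechet_derivative Y (at q) (X q)) w = 0" for w
  proof -
    have "((\<lambda>q. ric C (Y q) w) has_derivative (\<lambda>d. ric C (frechet_derivative Y (at q) d) w)) (at q)"
      by (rule bounded_linear.has_derivative[OF ric.bounded_linear_left smooth_on_has_derivative(1)[OF Y(1) U]])
    moreover have "((\<lambda>q. ric C (Y q) w) has_derivative (\<lambda>_. 0)) (at q)"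
      by (rule has_derivative_transform_within_open[OF has_derivative_const U]) (simp add: 0)
    ultimately show ?thesis
      by (metis has_derivative_unique)
  qed
  then show "nabla C X Y q \<in> ricci_kernel C q"
    by (simp add: ricci_kernel_def ricci_eq_ric nabla_eq ric.add_left ric_cmult[OF C x] 0[OF U(2)])
qed

section \<open>The invariants alpha and epsilon\<close>

text \<open>Since \<nabla>\<rho>(y,y;y) = 2 \<omega>(y) \<rho>(y,y), the quantity is 4 \<omega>(y)^2
  / \<rho>(y,y). Numerator and denominator are both multiples of \<rho>(y,x)^2, so \<open>y\<close>
  cancels.\<close>

lemma alpha_at_eq:
  assumes C: "ricci_rank C 0 = 1" "torsion_free C"
    and x: "ric C x x \<noteq> 0" and y: "ric C y y \<noteq> 0"
  shows "alpha_at C p y = 4 * (ric_form C x x)\<^sup>2 / ric C x x"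
proof -
  have "ric_form C x y * ric C x x = ric_form C x x * ric C y x"
    by (simp add: ric_form_def)
  then have *: "(ric_form C x y)\<^sup>2 * (ric C x x)\<^sup>2 = (ric_form C x x)\<^sup>2 * (ric C y x)\<^sup>2"
    by (metis power_mult_distrib)
  have "(ric C y x)\<^sup>2 = ric C x x * ric C y y"
    using ric_rank_one[OF C, of x y y] by (simp add: power2_eq_square)
  with * have eq: "(ric_form C x y)\<^sup>2 * ric C x x = (ric_form C x x)\<^sup>2 * ric C y y"
    using x by (simp add: power2_eq_square)
  have "cov_deriv C (ricci_tensor C) p [y, y, y] = 2 * ric_form C x y * ric C y y"
    by (simp add: cov_deriv_ric ric_cmult[OF C x] ric_cmult_right[OF C x])
  then have "alpha_at C p y = 4 * (ric_form C x y)\<^sup>2 / ric C y y"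
    using y by (simp add: alpha_at_def ricci_eq_ric power2_eq_square power3_eq_cube)
  also have "\<dots> = 4 * (ric_form C x x)\<^sup>2 / ric C x x"
    using eq x y by (simp add: field_simps)
  finally show ?thesis .
qed

text \<open>By rank one, \<rho>(x,x) \<rho>(y,y) is a square, so the two values have the same
  sign.\<close>

lemma epsilon_at_eq:
  assumes C: "ricci_rank C 0 = 1" "torsion_free C"
    and x: "ric C x x \<noteq> 0" and y: "ric C y y \<noteq> 0"
  shows "epsilon_at C p y = sgn (ric C x x)"
proof -
  have "ric C x x * ric C y y = (ric C y x)\<^sup>2"
    using ric_rank_one[OF C, of x y y] by (simp add: power2_eq_square)
  then have "ric C x x * ric C y y > 0"
    using x y by (metis mult_eq_0_iff zero_less_power2 power2_eq_iff_nonneg zero_eq_power2)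
  then show ?thesis
    by (auto simp: epsilon_at_def ricci_eq_ric zero_less_mult_iff)
qed

lemma alpha_inv_eq:
  assumes C: "ricci_rank C 0 = 1" "torsion_free C" and x: "ric C x x \<noteq> 0"
  shows "alpha_at C p x = alpha_inv C"
  unfolding alpha_inv_def
proof (rule the_equality[symmetric])
  show "\<forall>q y. ricci C q y y \<noteq> 0 \<longrightarrow> alpha_at C q y = alpha_at C p x"
    using alpha_at_eq[OF C x] x by (simp add: ricci_eq_ric)
\<comment> \<open>Uniqueness: any other candidate is evaluated at \<open>x\<close> itself.\<close>
qed (use x in \<open>auto simp: ricci_eq_ric\<close>)

lemma epsilon_inv_eq:
  assumes C: "ricci_rank C 0 = 1" "torsion_free C" and x: "ric C x x \<noteq> 0"
  shows "epsilon_at C p x = epsilon_inv C"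
  unfolding epsilon_inv_def
proof (rule the_equality[symmetric])
  show "\<forall>q y. ricci C q y y \<noteq> 0 \<longrightarrow> epsilon_at C q y = epsilon_at C p x"
    using epsilon_at_eq[OF C x] x by (simp add: ricci_eq_ric)
qed (use x in \<open>auto simp: ricci_eq_ric\<close>)

section \<open>Invariance under affine diffeomorphisms\<close>

text \<open>Differentiating \<open>D\<^sup>2f(u,v) = S(u,v) = J (u * v) - J u *' J v\<close> once more and using that third derivatives
  commute turns the intertwining of the connections into that of the curvatures; the terms that
  are not of the form of a curvature are symmetric in the two directions.\<close>

lemma affine_map_curvature:
  assumes C: "torsion_free C" "torsion_free C'"
    and U: "open U" "p \<in> U"
    and J: "\<And>q w. q \<in> U \<Longrightarrow> ((\<lambda>x. J x w) has_derivative (\<lambda>u. S q u w)) (at q)"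
    and lin: "linear (J p)"
    and S: "\<And>q u w. q \<in> U \<Longrightarrow> S q u w = J q (cmult C u w) - cmult C' (J q u) (J q w)"
  shows "J p (cmult C u (cmult C v w) - cmult C v (cmult C u w))
    = cmult C' (J p u) (cmult C' (J p v) (J p w)) - cmult C' (J p v) (cmult C' (J p u) (J p w))"
proof -
  note comm = torsion_free_cmult_commute[OF C(1)] torsion_free_cmult_commute[OF C(2)]
  \<comment> \<open>The product rule applied to the formula for \<open>S\<close>. If
    \<open>J\<close> is the differential of a map, \<open>A u q t\<close> is its third derivative in
    the directions \<open>w\<close>, \<open>u\<close>, \<open>t\<close>.\<close>
  define A where "A u q t = S q t (cmult C u w) - (cmult C' (J q u) (S q t w) + cmult C' (S q t u) (J q w))"
    for u q t
  have dS: "((\<lambda>q. S q u w) has_derivative A u q) (at q)" if q: "q \<in> U" for q u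
  proof -
    have "((\<lambda>q. J q (cmult C u w) - cmult C' (J q u) (J q w)) has_derivative A u q) (at q)"
      unfolding A_def by (intro has_derivative_diff J[OF q] cmult.FDERIV)
    then show ?thesis
      by (rule has_derivative_transform_within_open[OF _ U(1) q]) (simp add: S)
  qed
  \<comment> \<open>Continuity passes from \<open>J\<close> to \<open>S\<close> and then to
    \<open>A\<close>, as both are built from \<open>J\<close> by products.\<close>
  have contJ: "continuous_on U (\<lambda>q. J q u)" for u
    using J has_derivative_continuous by (metis continuous_at_imp_continuous_on)
  have contS: "continuous_on U (\<lambda>q. S q t u)" for t u
    by (subst continuous_on_cong[OF refl S]) (auto intro!: continuous_intros contJ cmult.continuous_on)
  have contA: "continuous_on U (\<lambda>q. A u q t)" for u t
    unfolding A_def by (intro continuous_intros contJ contS cmult.continuous_on)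
  have "A u p v $ k = A v p u $ k" for k
  proof (rule second_derivative_symmetric[where h = "\<lambda>q. J q w $ k" and h' = "\<lambda>q u. S q u w $ k"
          and A = "\<lambda>q t. A u q t $ k" and B = "\<lambda>q t. A v q t $ k" and u = u and v = v, OF U])
    show "((\<lambda>q. J q w $ k) has_derivative (\<lambda>u. S q u w $ k)) (at q)" if "q \<in> U" for q
      by (rule bounded_linear.has_derivative[OF bounded_linear_vec_nth J[OF that]])
    show "((\<lambda>q. S q u w $ k) has_derivative (\<lambda>t. A u q t $ k)) (at q)" if "q \<in> U" for q u
      by (rule bounded_linear.has_derivative[OF bounded_linear_vec_nth dS[OF that]])
    then show "((\<lambda>q. S q v w $ k) has_derivative (\<lambda>t. A v q t $ k)) (at q)" if "q \<in> U" for q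
      using that by blast
  qed (intro continuous_intros contA)+
  then have "A u p v = A v p u"
    by (simp add: vec_eq_iff)
  then show ?thesis
    by (simp add: A_def S[OF U(2)] comm(1)[of v u] comm(2)[of "J p v" "J p u"] linear_diff[OF lin]
        cmult.diff_left cmult.diff_right algebra_simps)
qed

text \<open>The endomorphism whose trace defines the form of \<open>C'\<close> is conjugate by
  \<open>j\<close> to that of \<open>C\<close>, and the trace is invariant under
  conjugation.\<close>

lemma ric_invariant:
  assumes lin: "linear j" "linear g" and inv: "\<And>x. g (j x) = x" "\<And>y. j (g y) = y"
    and R: "\<And>u v w. j (cmult C u (cmult C v w) - cmult C v (cmult C u w))
      = cmult C' (j u) (cmult C' (j v) (j w)) - cmult C' (j v) (cmult C' (j u) (j w))"
  shows "ric C' (j v) (j w) = ric C v w"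
proof -
  define L where "L u = cmult C u (cmult C v w) - cmult C v (cmult C u w)" for u
  have "linear L"
    unfolding L_def by (intro linearI)
      (simp_all add: cmult.add_left cmult.add_right cmult.scaleR_left cmult.scaleR_right algebra_simps)
  have "(\<lambda>x. cmult C' x (cmult C' (j v) (j w)) - cmult C' (j v) (cmult C' x (j w))) = j \<circ> L \<circ> g"
    using R[of "g x" v w for x] by (auto simp: L_def inv)
  then have "ric C' (j v) (j w) = trace (matrix j ** (matrix L ** matrix g))"
    using lin \<open>linear L\<close> by (simp add: ric_def matrix_compose linear_compose matrix_mul_assoc)
  also have "\<dots> = trace ((matrix L ** matrix g) ** matrix j)"
    by (rule trace_mul_sym)
  also have "\<dots> = trace (matrix L ** matrix (g \<circ> j))"
    using lin by (simp add: matrix_compose matrix_mul_assoc)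
  also have "matrix (g \<circ> j) = mat 1"
    using inv by (simp add: comp_def matrix_id_mat_1[unfolded id_def])
  finally show ?thesis
    by (simp add: ric_def L_def[abs_def])
qed

text \<open>The map \<open>j\<close> is the differential of the affine diffeomorphism at one point.
  It preserves \<rho> by the two preceding lemmas; differentiating this relation along the domain
  gives the statement for \<nabla>\<rho>.\<close>

lemma locally_affine_equivalent_ric:
  assumes C: "torsion_free C" "torsion_free C'" and eq: "locally_affine_equivalent C C'"
  obtains j where "\<And>v w. ric C' (j v) (j w) = ric C v w"
    "\<And>p p' u v w. cov_deriv C' (ricci_tensor C') p' [j u, j v, j w] = cov_deriv C (ricci_tensor C) p [u, v, w]"
proof -
  obtain U V f g where UV: "open U" "open V" "U \<noteq> {}" "homeomorphism U V f g" "smooth_on U f" "smooth_on V g"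
    and aff: "\<And>X Y q. smooth_on U X \<Longrightarrow> smooth_on U Y \<Longrightarrow> q \<in> V \<Longrightarrow>
        nabla C' (push_forward f g X) (push_forward f g Y) q = push_forward f g (nabla C X Y) q"
    using eq unfolding locally_affine_equivalent_def by blast
  have fg: "f q \<in> V" "g (f q) = q" if "q \<in> U" for q
    using UV(4) that by (auto simp: homeomorphism_def)
  have gf: "g q \<in> U" "f (g q) = q" if "q \<in> V" for q
    using UV(4) that by (auto simp: homeomorphism_def)
  define J where "J q v = frechet_derivative f (at q) v" for q v
  define G where "G q v = frechet_derivative g (at q) v" for q v
  define S where "S q u w = frechet_derivative (\<lambda>x. J x w) (at q) u" for q u w
  have df: "(f has_derivative J q) (at q)" if "q \<in> U" for q
    using smooth_on_has_derivative(1)[OF UV(5,1) that] by (simp add: J_def[abs_def])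
  have dg: "(g has_derivative G q) (at q)" if "q \<in> V" for q
    using smooth_on_has_derivative(1)[OF UV(6,2) that] by (simp add: G_def[abs_def])
  have dJ: "((\<lambda>x. J x w) has_derivative (\<lambda>u. S q u w)) (at q)" if "q \<in> U" for q w
    using smooth_on_has_derivative(2)[OF UV(5,1) that, of w] by (simp add: J_def S_def)
  have linJ: "linear (J q)" if "q \<in> U" for q
    using df[OF that] has_derivative_linear by blast
  have GJ: "G (f q) (J q x) = x" if "q \<in> U" for q x
  proof -
    have "((\<lambda>x. g (f x)) has_derivative (\<lambda>x. G (f q) (J q x))) (at q)"
      by (rule has_derivative_compose[OF df[OF that] dg[OF fg(1)[OF that]]])
    moreover have "((\<lambda>x. g (f x)) has_derivative (\<lambda>x. x)) (at q)"
      by (rule has_derivative_transform_within_open[OF has_derivative_ident UV(1) that]) (simp add: fg)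
    ultimately show ?thesis
      by (metis has_derivative_unique)
  qed
  have S: "S q u w = J q (cmult C u w) - cmult C' (J q u) (J q w)" if q: "q \<in> U" for q u w
  proof -
    \<comment> \<open>Pushing a constant field \<open>w\<close> forward gives the field
      \<open>J (g y) w\<close>; its derivative, taken along the image of \<open>u\<close>, is the
      second derivative of \<open>f\<close>.\<close>
    have "((\<lambda>y. J (g y) w) has_derivative (\<lambda>x. S q (G (f q) x) w)) (at (f q))"
      using has_derivative_compose[OF dg[OF fg(1)[OF q]], of "\<lambda>y. J y w" "\<lambda>u. S q u w"] dJ[OF q] fg(2)[OF q]
      by simp
    then have "frechet_derivative (\<lambda>y. J (g y) w) (at (f q)) = (\<lambda>x. S q (G (f q) x) w)"
      by (metis frechet_derivative_at)
    moreover have "nabla C' (push_forward f g (\<lambda>_. u)) (push_forward f g (\<lambda>_. w)) (f q)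
        = push_forward f g (nabla C (\<lambda>_. u) (\<lambda>_. w)) (f q)"
      by (rule aff[OF smooth_on_const smooth_on_const fg(1)[OF q]])
    ultimately show ?thesis
      unfolding nabla_eq nabla_const push_forward_def J_def[symmetric] fg(2)[OF q] GJ[OF q]
      by (simp add: GJ[OF q] algebra_simps)
  qed
  have ric: "ric C' (J q v) (J q w) = ric C v w" if q: "q \<in> U" for q v w
  proof (rule ric_invariant[OF linJ[OF q], where g = "G (f q)"])
    show "linear (G (f q))"
      using dg[OF fg(1)[OF q]] has_derivative_linear by blast
    show "G (f q) (J q x) = x" for x
      by (rule GJ[OF q])
    \<comment> \<open>In finite dimension the left inverse of \<open>J q\<close> is also a right
      inverse.\<close>
    then have "inj (J q)"
      by (metis injI)
    then have "surj (J q)"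
      using linJ[OF q] linear_injective_imp_surjective by blast
    then show "J q (G (f q) y) = y" for y
      using GJ[OF q] by (metis surjD)
    show "J q (cmult C u (cmult C v w) - cmult C v (cmult C u w))
      = cmult C' (J q u) (cmult C' (J q v) (J q w)) - cmult C' (J q v) (cmult C' (J q u) (J q w))" for u v w
      by (rule affine_map_curvature[where S = S, OF C UV(1) q dJ linJ[OF q] S])
  qed
  obtain p where p: "p \<in> U"
    using UV(3) by blast
  have d: "ric C' (J p v) (S p t w) + ric C' (S p t v) (J p w) = 0" for t v w
  proof -
    have 1: "((\<lambda>q. ric C' (J q v) (J q w)) has_derivative (\<lambda>t. ric C' (J p v) (S p t w) + ric C' (S p t v) (J p w))) (at p)"
      by (rule ric.FDERIV[OF dJ[OF p] dJ[OF p]])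
    have 2: "((\<lambda>q. ric C' (J q v) (J q w)) has_derivative (\<lambda>_. 0)) (at p)"
      by (rule has_derivative_transform_within_open[OF has_derivative_const UV(1) p]) (simp add: ric)
    show ?thesis
      using fun_cong[OF has_derivative_unique[OF 1 2], of t] .
  qed
  have "cov_deriv C' (ricci_tensor C') p' [J p t, J p v, J p w] = cov_deriv C (ricci_tensor C) p'' [t, v, w]"
    for p' p'' t v w
    using d[of v t w] unfolding S[OF p] ric.diff_left ric.diff_right ric[OF p] cov_deriv_ric by linarith
  with ric[OF p] show ?thesis
    by (rule that)
qed

theorem lemma2p5:
  fixes C :: christoffel
  assumes tf: "torsion_free C"
    and nonflat: "\<not> flat C"
    and rank1: "\<And>p. ricci_rank C p = 1"
  shows "(\<exists>w. one_form w \<and>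
            (\<forall>k p vs. length vs = k + 2 \<longrightarrow>
               (cov_deriv C ^^ k) (ricci_tensor C) p vs
                 = fact (k + 1) * tensor_prod k (form_power w k) (ricci_tensor C) p vs))
       \<and> recurrent C 2 (ricci_tensor C)
       \<and> parallel_distribution C (ricci_kernel C)
       \<and> ((\<forall>p. \<exists>x. ricci C p x x \<noteq> 0)
          \<and> (\<forall>p x. ricci C p x x \<noteq> 0 \<longrightarrow>
               alpha_at C p x = alpha_inv C \<and> epsilon_at C p x = epsilon_inv C)
          \<and> epsilon_inv C \<in> {1, -1}
          \<and> (\<forall>C'. torsion_free C' \<longrightarrow> \<not> flat C' \<longrightarrow> (\<forall>p. ricci_rank C' p = 1) \<longrightarrow>
               locally_affine_equivalent C C' \<longrightarrow>
               alpha_inv C' = alpha_inv C \<and> epsilon_inv C' = epsilon_inv C))"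
proof -
  note C = rank1[of 0] tf
  obtain x where x: "ric C x x \<noteq> 0"
    using ric_det(2)[OF C] by blast
  have "epsilon_inv C \<in> {1, -1}"
    using x epsilon_inv_eq[OF C x, of 0] by (auto simp: epsilon_at_def ricci_eq_ric sgn_if split: if_splits)
  moreover have "alpha_inv C' = alpha_inv C \<and> epsilon_inv C' = epsilon_inv C"
    if tf': "torsion_free C'" and rank1': "\<forall>p. ricci_rank C' p = 1" and aff: "locally_affine_equivalent C C'" for C'
  proof -
    have C': "ricci_rank C' 0 = 1" "torsion_free C'"
      using tf' rank1' by auto
    obtain j where j: "\<And>v w. ric C' (j v) (j w) = ric C v w"
      "\<And>p p' u v w. cov_deriv C' (ricci_tensor C') p' [j u, j v, j w] = cov_deriv C (ricci_tensor C) p [u, v, w]"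
      using locally_affine_equivalent_ric[OF tf tf' aff] by metis
    \<comment> \<open>Any vector with nonzero Ricci value computes the invariants, so
      \<open>x\<close> and \<open>j x\<close> may be compared.\<close>
    have "ric C' (j x) (j x) \<noteq> 0"
      using x j(1) by simp
    moreover have "alpha_at C' 0 (j x) = alpha_at C 0 x" "epsilon_at C' 0 (j x) = epsilon_at C 0 x"
      using j(1) j(2)[of 0 x x x 0] by (simp_all add: alpha_at_def epsilon_at_def ricci_eq_ric)
    ultimately show ?thesis
      using alpha_inv_eq[OF C'] epsilon_inv_eq[OF C'] alpha_inv_eq[OF C x] epsilon_inv_eq[OF C x] by metis
  qed
  moreover have "(cov_deriv C ^^ k) (ricci_tensor C) p vs
      = fact (k + 1) * tensor_prod k (form_power (\<lambda>_. ric_form C x) k) (ricci_tensor C) p vs"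
    if "length vs = k + 2" for k p vs
    by (rule iterated_cov_deriv_ric[OF C x that])
  moreover have "\<forall>p. \<exists>x. ricci C p x x \<noteq> 0"
    using x by (auto simp: ricci_eq_ric)
  moreover have "alpha_at C p y = alpha_inv C \<and> epsilon_at C p y = epsilon_inv C" if "ricci C p y y \<noteq> 0" for p y
    using alpha_inv_eq[OF C] epsilon_inv_eq[OF C] that by (simp add: ricci_eq_ric)
  ultimately show ?thesis
    using one_form_ric_form recurrent_ric[OF C] parallel_ricci_kernel[OF C] by blast
qed

end
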